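(* For every $n,m\ge1$ there exists a matrix $E_{n,m}\in\mathbb R^{(n+m-1)\times nm}$ (called the L-eliminating matrix) such that for every matrix $A\in\mathbb R^{n\times m}$, $$E_{n,m}\,vec(A)=vecL(A),$$ and it is given by $$E_{n,m}=\sum_{i=1}^n\vec e_{n+m-1,i}\otimes\vec e_{m,1}^{\top}\otimes\vec e_{n,i}^{\top}+\sum_{i=2}^m\vec e_{n+m-1,n+i-1}\otimes\vec e_{m,i}^{\top}\otimes\vec e_{n,n}^{\top}.$$
   Context: $vec(A)\in\mathbb R^{nm}$ is the column vector obtained by stacking the columns of $A\in\mathbb R^{n\times m}$. For $A=(a_{i,j})\in\mathbb R^{n\times m}$, the L-vectorization is the first column followed by the rest of the last row: $vecL(A)=(a_{1,1},a_{2,1},\dots,a_{n,1},a_{n,2},\dots,a_{n,m})^{\top}\in\mathbb R^{n+m-1}$. $\vec e_{k,j}$ is the $j$-th canonical basis (column) vector of $\mathbb R^k$ and $\otimes$ is the Kronecker product. *)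

theory Defs
  imports "Jordan_Normal_Form.Matrix"
begin

definition kron :: "real mat \<Rightarrow> real mat \<Rightarrow> real mat"  (infixl \<open>\<otimes>\<^sub>K\<close> 70)
  where "A \<otimes>\<^sub>K B =
    mat (dim_row A * dim_row B) (dim_col A * dim_col B)
      (\<lambda>(i, j). A $$ (i div dim_row B, j div dim_col B) * B $$ (i mod dim_row B, j mod dim_col B))"

text \<open>The canonical basis vector of \<open>\<real>\<^sup>k\<close> as a \<open>k \<times> 1\<close> matrix, so that it can be transposed and
  Kronecker-multiplied. The index \<open>j\<close> runs from \<open>1\<close> to \<open>k\<close>, whereas \<^const>\<open>unit_vec\<close> counts from \<open>0\<close>.\<close>
definition basis_col :: "nat \<Rightarrow> nat \<Rightarrow> real mat"
  where "basis_col k j = mat_of_cols k [unit_vec k (j - 1)]"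

text \<open>Stacking the columns of an \<open>n \<times> m\<close> matrix puts the \<open>(i, j)\<close> entry (counted from \<open>0\<close>) at
  position \<open>j * n + i\<close>.\<close>
definition vectorize :: "real mat \<Rightarrow> real vec"
  where "vectorize A = vec (dim_row A * dim_col A) (\<lambda>k. A $$ (k mod dim_row A, k div dim_row A))"

definition vecL :: "real mat \<Rightarrow> real vec"
  where "vecL A = col A 0 @\<^sub>v vec (dim_col A - 1) (\<lambda>j. A $$ (dim_row A - 1, j + 1))"

end

(* Every summand of E is a matrix unit: e_r (x) e_j^T (x) e_i^T has its only nonzero entry in row r,
   at the column where vec stores the entry (i, j). It therefore copies a_{i,j} to position r. *)
theory Submission
  imports Defs
begin

text \<open>Counting from 0, each Kronecker summand is a matrix unit
  (\<open>kron_basis_eq_elementary_mat\<close>), so applied to \<open>vectorize A\<close> it moves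
  one entry of A to one position and is zero elsewhere
  (\<open>elementary_mat_mult_vec_index\<close>, \<open>vectorize_index\<close>). Reading off
  coordinate k of the product distributes over the matrix sums
  (\<open>finsum_mat_mult_vec_index\<close>), and exactly one summand has its row at k: one from the
  first sum if k < n, supplying the first column, and one from the second sum if k \<ge> n,
  supplying the last row from the second column on. These are the entries of
  \<open>vecL A\<close>.\<close>

definition elementary_mat :: "nat \<Rightarrow> nat \<Rightarrow> nat \<Rightarrow> nat \<Rightarrow> real mat"
  where "elementary_mat nr nc a b = mat nr nc (\<lambda>(i, j). if i = a \<and> j = b then 1 else 0)"

lemma elementary_mat_carrier [simp]: "elementary_mat nr nc a b \<in> carrier_mat nr nc"
  by (simp add: elementary_mat_def)

lemma elementary_mat_mult_vec_index:
  assumes "v \<in> carrier_vec nc" "b < nc" "k < nr"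
  shows "(elementary_mat nr nc a b *\<^sub>v v) $ k = (if k = a then v $ b else 0)"
proof -
  have "(elementary_mat nr nc a b *\<^sub>v v) $ k
      = (\<Sum>j\<in>{0..<nc}. (if k = a \<and> j = b then 1 else 0) * v $ j)"
    using assms by (simp add: elementary_mat_def scalar_prod_def)
  also have "\<dots> = (\<Sum>j\<in>{0..<nc}. if j = b then (if k = a then v $ b else 0) else 0)"
    by (rule sum.cong) auto
  finally show ?thesis
    using assms by simp
qed

text \<open>Both transposed factors have a single row, so entry (a, b) is a product of three
  indicators: a = r - 1, b div n = j - 1 and b mod n = i - 1. By uniqueness of quotient and
  remainder the last two single out one column, the place where \<open>vectorize\<close> stores the
  (i, j) entry.\<close>

lemma kron_basis_eq_elementary_mat:
  assumes "1 \<le> r" "r \<le> N" "1 \<le> j" "j \<le> m" "1 \<le> i" "i \<le> n"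
  shows "basis_col N r \<otimes>\<^sub>K transpose_mat (basis_col m j) \<otimes>\<^sub>K transpose_mat (basis_col n i)
    = elementary_mat N (n * m) (r - 1) ((j - 1) * n + (i - 1))"
proof (rule eq_matI)
  fix a b
  assume "a < dim_row (elementary_mat N (n * m) (r - 1) ((j - 1) * n + (i - 1)))"
    and "b < dim_col (elementary_mat N (n * m) (r - 1) ((j - 1) * n + (i - 1)))"
  then have a: "a < N" and b: "b < n * m"
    by (simp_all add: elementary_mat_def)
  have bd: "b div n < m"
    using b by (simp add: less_mult_imp_div_less mult.commute)
  have bm: "b mod n < n"
    using assms by simp
  \<comment> \<open>The 0-based indices, named to get rid of truncated subtraction.\<close>
  obtain i' j' where ij: "i = Suc i'" "j = Suc j'"
    using assms by (metis Suc_le_D One_nat_def)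
  have "b div n = j' \<and> b mod n = i' \<longleftrightarrow> b = j' * n + i'"
    using assms ij div_mult_mod_eq[of b n] by auto
  then show "(basis_col N r \<otimes>\<^sub>K transpose_mat (basis_col m j) \<otimes>\<^sub>K transpose_mat (basis_col n i)) $$ (a, b)
      = elementary_mat N (n * m) (r - 1) ((j - 1) * n + (i - 1)) $$ (a, b)"
    using a b bd bm assms ij
    by (auto simp: kron_def basis_col_def elementary_mat_def mat_of_cols_def mult.commute[of m])
qed (simp_all add: kron_def basis_col_def elementary_mat_def mult.commute)

lemma finsum_mat_closed:
  assumes "\<And>i. i \<in> S \<Longrightarrow> f i \<in> carrier_mat nr nc"
  shows "finsum (module_mat TYPE('b :: comm_ring_1) nr nc) f S \<in> carrier_mat nr nc"
proof -
  interpret abelian_group "module_mat TYPE('b) nr nc"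
    by (rule abelian_group_mat)
  show ?thesis
    using finsum_closed[of f S] assms by (auto simp: module_mat_simps)
qed

text \<open>Passes from the sum in the abelian group of nr by nc matrices to an ordinary sum of
  scalars, by induction on S with distributivity of the matrix-vector product. The carrier
  assumption on f is what lets \<open>finsum_insert\<close> split off a term.\<close>

lemma finsum_mat_mult_vec_index:
  fixes v :: "'b :: comm_ring_1 vec"
  assumes "finite S" "\<And>i. i \<in> S \<Longrightarrow> f i \<in> carrier_mat nr nc" "v \<in> carrier_vec nc" "k < nr"
  shows "(finsum (module_mat TYPE('b) nr nc) f S *\<^sub>v v) $ k = (\<Sum>i\<in>S. (f i *\<^sub>v v) $ k)"
proof -
  let ?M = "module_mat TYPE('b) nr nc"
  interpret abelian_group ?M
    by (rule abelian_group_mat)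
  show ?thesis
    using assms(1,2)
  proof (induction S rule: finite_induct)
    case empty
    then show ?case
      using assms(3,4) finsum_empty[of f] by (simp add: module_mat_simps)
  next
    case (insert x F)
    have F: "finsum ?M f F \<in> carrier_mat nr nc"
      using insert.prems by (intro finsum_mat_closed) simp
    have x: "f x \<in> carrier_mat nr nc"
      using insert.prems by simp
    have "finsum ?M f (insert x F) = f x + finsum ?M f F"
      using insert finsum_insert[of F x f] by (auto simp: module_mat_simps)
    then have "(finsum ?M f (insert x F) *\<^sub>v v) $ k = (f x *\<^sub>v v) $ k + (finsum ?M f F *\<^sub>v v) $ k"
      using F x assms(3,4) by (simp add: add_mult_distrib_mat_vec[OF x F assms(3)])
    then show ?case
      using insert by simp
  qed
qed

lemma column_major_index_less:
  fixes i j n m :: nat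
  assumes "i < n" "j < m"
  shows "j * n + i < n * m"
proof -
  have "j * n + i < Suc j * n"
    using assms by simp
  also have "\<dots> \<le> m * n"
    using assms by (intro mult_le_mono1) simp
  finally show ?thesis
    by (simp add: mult.commute)
qed

lemma vectorize_index:
  assumes "A \<in> carrier_mat n m" "i < n" "j < m"
  shows "vectorize A $ (j * n + i) = A $$ (i, j)"
  using assms column_major_index_less[of i n j m] by (simp add: vectorize_def)

theorem theorem3p1:
  fixes n m :: nat
  assumes "n \<ge> 1" and "m \<ge> 1"
  shows "\<exists>E \<in> carrier_mat (n + m - 1) (n * m).
    (\<forall>A \<in> carrier_mat n m. E *\<^sub>v vectorize A = vecL A) \<and>
    E = (\<Oplus>\<^bsub>module_mat TYPE(real) (n + m - 1) (n * m)\<^esub> i\<in>{1..n}.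
           basis_col (n + m - 1) i \<otimes>\<^sub>K transpose_mat (basis_col m 1)
             \<otimes>\<^sub>K transpose_mat (basis_col n i))
      + (\<Oplus>\<^bsub>module_mat TYPE(real) (n + m - 1) (n * m)\<^esub> i\<in>{2..m}.
           basis_col (n + m - 1) (n + i - 1) \<otimes>\<^sub>K transpose_mat (basis_col m i)
             \<otimes>\<^sub>K transpose_mat (basis_col n n))"
proof -
  let ?N = "n + m - 1"
  let ?f = "\<lambda>i. basis_col ?N i \<otimes>\<^sub>K transpose_mat (basis_col m 1) \<otimes>\<^sub>K transpose_mat (basis_col n i)"
  let ?g = "\<lambda>i. basis_col ?N (n + i - 1) \<otimes>\<^sub>K transpose_mat (basis_col m i)
    \<otimes>\<^sub>K transpose_mat (basis_col n n)"
  let ?M = "module_mat TYPE(real) ?N (n * m)"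
  let ?F = "finsum ?M ?f {1..n}"
  let ?G = "finsum ?M ?g {2..m}"
  have f: "?f i = elementary_mat ?N (n * m) (i - 1) (0 * n + (i - 1))" if i: "i \<in> {1..n}" for i
  proof -
    have "i \<le> ?N"
      using i assms by auto
    then show ?thesis
      using kron_basis_eq_elementary_mat[of i ?N 1 m i n] i assms by simp
  qed
  have g: "?g i = elementary_mat ?N (n * m) (n + i - 2) ((i - 1) * n + (n - 1))" if i: "i \<in> {2..m}" for i
  proof -
    have "1 \<le> n + i - 1" "n + i - 1 \<le> ?N"
      using i assms by auto
    then show ?thesis
      using kron_basis_eq_elementary_mat[of "n + i - 1" ?N i m n n] i assms
      by (simp add: numeral_2_eq_2)
  qed
  have fc: "?f i \<in> carrier_mat ?N (n * m)" if "i \<in> {1..n}" for i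
    unfolding f[OF that] by simp
  have gc: "?g i \<in> carrier_mat ?N (n * m)" if "i \<in> {2..m}" for i
    unfolding g[OF that] by simp
  have F: "?F \<in> carrier_mat ?N (n * m)"
    by (rule finsum_mat_closed[OF fc])
  have G: "?G \<in> carrier_mat ?N (n * m)"
    by (rule finsum_mat_closed[OF gc])
  \<comment> \<open>The witness is the formula itself, so only its action and its dimensions have to
    be checked.\<close>
  have "(?F + ?G) *\<^sub>v vectorize A = vecL A" if A: "A \<in> carrier_mat n m" for A
  proof (rule eq_vecI)
    have v: "vectorize A \<in> carrier_vec (n * m)"
      using A by (simp add: vectorize_def)
    show "dim_vec ((?F + ?G) *\<^sub>v vectorize A) = dim_vec (vecL A)"
      using A G assms by (simp add: vecL_def)
    fix k
    assume "k < dim_vec (vecL A)"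
    then have k: "k < ?N"
      using A assms by (simp add: vecL_def)
    have fk: "(?f i *\<^sub>v vectorize A) $ k = (if i = k + 1 then A $$ (k, 0) else 0)"
      if i: "i \<in> {1..n}" for i
      unfolding f[OF i]
      using i assms k column_major_index_less[of "i - 1" n 0 m] vectorize_index[OF A, of "i - 1" 0]
      by (subst elementary_mat_mult_vec_index[OF v]) auto
    have gk: "(?g i *\<^sub>v vectorize A) $ k = (if i = k + 2 - n then A $$ (n - 1, k + 1 - n) else 0)"
      if i: "i \<in> {2..m}" for i
    proof -
      \<comment> \<open>Solving for i is safe under truncated subtraction because i \<ge> 2: if k +
        2 < n, both equations fail.\<close>
      have "k = n + i - 2 \<longleftrightarrow> i = k + 2 - n" and "i = k + 2 - n \<Longrightarrow> i - 1 = k + 1 - n"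
        using i assms by auto
      then show ?thesis
        unfolding g[OF i]
        using i assms k column_major_index_less[of "n - 1" n "i - 1" m] vectorize_index[OF A, of "n - 1" "i - 1"]
        by (subst elementary_mat_mult_vec_index[OF v]) auto
    qed
    have "((?F + ?G) *\<^sub>v vectorize A) $ k = (?F *\<^sub>v vectorize A) $ k + (?G *\<^sub>v vectorize A) $ k"
      unfolding add_mult_distrib_mat_vec[OF F G v]
      by (rule index_add_vec(1)) (use k carrier_matD(1)[OF G] in simp)
    also have "\<dots> = (\<Sum>i\<in>{1..n}. (?f i *\<^sub>v vectorize A) $ k) + (\<Sum>i\<in>{2..m}. (?g i *\<^sub>v vectorize A) $ k)"
      using finsum_mat_mult_vec_index[OF _ fc v k, of "{1..n}"]
        finsum_mat_mult_vec_index[OF _ gc v k, of "{2..m}"] by simp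
    also have "\<dots> = (\<Sum>i\<in>{1..n}. if i = k + 1 then A $$ (k, 0) else 0)
        + (\<Sum>i\<in>{2..m}. if i = k + 2 - n then A $$ (n - 1, k + 1 - n) else 0)"
      by (intro arg_cong2[of _ _ _ _ "(+)"] sum.cong refl fk gk)
    also have "\<dots> = vecL A $ k"
    \<comment> \<open>The corner entry sits at k = n - 1 and comes from the first sum alone: for k <
      n the index k + 2 - n is at most 1, below the range of the second sum.\<close>
    proof (cases "k < n")
      case True
      then have "k + 2 - n \<notin> {2..m}"
        by auto
      with True show ?thesis
        using A assms by (simp add: vecL_def)
    next
      case False
      \<comment> \<open>Now k + 1 > n silences the first sum, and k < n + m - 1 bounds the index by
        m. The second equation matches the column \<open>j + 1\<close> in \<open>vecL\<close>, taken
        at j = k - n.\<close>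
      then have "k + 2 - n \<in> {2..m}" "Suc (k - n) = k + 1 - n"
        using k by auto
      then show ?thesis
        using False k A assms by (simp add: vecL_def)
    qed
    finally show "((?F + ?G) *\<^sub>v vectorize A) $ k = vecL A $ k" .
  qed
  moreover have "?F + ?G \<in> carrier_mat ?N (n * m)"
    using F G by simp
  ultimately show ?thesis
    by blast
qed

end
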